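(* Let $k\geq 2$ and let $\mathrm{DG}=(V,E,o,t,k,\phi)$ be a $k$-dimensional digraph, with colour decomposition $E=E_1\sqcup\dots\sqcup E_k$. Then there exist a small category $\Lambda_{\mathrm{DG}}$ with $V$ as set of objects and a functor $d:\Lambda_{\mathrm{DG}}\to\mathbb{N}^k$ which assigns the value (degree) $e_i$ to morphisms determined by edges in $E_i$, for all $1\leq i\leq k$. Moreover, the functor $d$ has the unique factorisation property and, in particular, $(\Lambda_{\mathrm{DG}},d)$ is a higher rank graph (a $k$-graph).
   Context: A $k$-dimensional digraph $\mathrm{DG}=(V,E,o,t,k,\phi)$ ($k\ge2$) is a finite directed graph (finite vertex set $V$, finite edge set $E$, origin and terminus maps $o,t:E\to V$; loops and multiple edges allowed) with a decomposition $E=E_1\sqcup\dots\sqcup E_k$ (edges in $E_i$ have colour $i$) and a bijection $\phi:Y\to Y$ on the set $Y$ of all directed paths $xy$ of length two (so $t(x)=o(y)$) whose two edges have distinct colours, such that: (F1) If $xy\in Y$ with $x$ of colour $i$ and $y$ of colour $j$, $i\ne j$, then $\phi(xy)=y'x'$ for a unique pair $(y',x')$ with $y'$ of colour $j$, $x'$ of colour $i$, and the origin and terminus vertices of the paths $xy$ and $y'x'$ coincide. This is written $xy\sim y'x'$, and $\phi^2=1$. (F2) For all $x\in E_i$, $y\in E_j$, $z\in E_l$ with $i,j,l$ distinct such that $xyz$ is a path: if $x_1,x_2,x^1,x^2\in E_i$, $y_1,y_2,y^1,y^2\in E_j$, $z_1,z_2,z^1,z^2\in E_l$ satisfy $xy\sim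 y^1x^1$, $x^1z\sim z^1x^2$, $y^1z^1\sim z^2y^2$ and $yz\sim z_1y_1$, $xz_1\sim z_2x_1$, $x_1y_1\sim y_2x_2$, then $x_2=x^2$, $y_2=y^2$, $z_2=z^2$. The category $\Lambda_{\mathrm{DG}}$ is the quotient of the free category on the directed graph $(V,E,o,t)$ (objects $V$; morphisms the finite directed paths, including an empty path at each vertex; the path $x_1x_2\cdots x_m$ is the morphism $x_m\circ\cdots\circ x_1$ from $o(x_1)$ to $t(x_m)$) by the congruence in which two paths are equivalent if one is obtained from the other by finitely many replacements of a consecutive bicoloured pair $x_sx_{s+1}\in Y$ by $\phi(x_sx_{s+1})$. A morphism determined by an edge is the class of the corresponding path of length one. Here $\mathbb{N}^k$ is a monoid under addition (viewed as a category with one object) with generators $e_1,\dots,e_k$. A $k$-graph (higher rank graph of rank $k$) is a countable small category $\Lambda$ with a functor $d:\Lambda\to\mathbb{N}^k$ satisfying the unique factorisation property: whenever $d(\pi)=m+n$ with $m,n\in\mathbb{N}^k$, there are unique morphisms $\mu,\nu$ with $\pi=\mu\nu$, $d(\mu)=m$, $d(\nu)=n$. *)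

theory Defs
  imports
    "Graph_Theory.Arc_Walk"
    "HOL-Library.Countable_Set"
    "HOL-Library.Disjoint_Sets"
    "HOL-Library.Function_Algebras"
begin

section \<open>Small categories and functors\<close>

text \<open>
  \<open>Comp C g f\<close> is the composite \<open>g \<circ> f\<close> (first \<open>f\<close>, then \<open>g\<close>); its value matters only
  when \<open>Dom C g = Cod C f\<close>.
\<close>

record ('o, 'm) category =
  Obj :: "'o set"
  Mor :: "'m set"
  Dom :: "'m \<Rightarrow> 'o"
  Cod :: "'m \<Rightarrow> 'o"
  Id :: "'o \<Rightarrow> 'm"
  Comp :: "'m \<Rightarrow> 'm \<Rightarrow> 'm"

locale small_category =
  fixes C :: "('o, 'm) category"
  assumes Dom_in: "f \<in> Mor C \<Longrightarrow> Dom C f \<in> Obj C"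
    and Cod_in: "f \<in> Mor C \<Longrightarrow> Cod C f \<in> Obj C"
    and Id_in: "a \<in> Obj C \<Longrightarrow> Id C a \<in> Mor C"
    and Dom_Id: "a \<in> Obj C \<Longrightarrow> Dom C (Id C a) = a"
    and Cod_Id: "a \<in> Obj C \<Longrightarrow> Cod C (Id C a) = a"
    and Comp_in: "\<lbrakk>f \<in> Mor C; g \<in> Mor C; Dom C g = Cod C f\<rbrakk> \<Longrightarrow> Comp C g f \<in> Mor C"
    and Dom_Comp: "\<lbrakk>f \<in> Mor C; g \<in> Mor C; Dom C g = Cod C f\<rbrakk> \<Longrightarrow> Dom C (Comp C g f) = Dom C f"
    and Cod_Comp: "\<lbrakk>f \<in> Mor C; g \<in> Mor C; Dom C g = Cod C f\<rbrakk> \<Longrightarrow> Cod C (Comp C g f) = Cod C g"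
    and Comp_Id: "f \<in> Mor C \<Longrightarrow> Comp C f (Id C (Dom C f)) = f"
    and Id_Comp: "f \<in> Mor C \<Longrightarrow> Comp C (Id C (Cod C f)) f = f"
    and Comp_assoc: "\<lbrakk>f \<in> Mor C; g \<in> Mor C; h \<in> Mor C; Dom C g = Cod C f; Dom C h = Cod C g\<rbrakk>
      \<Longrightarrow> Comp C (Comp C h g) f = Comp C h (Comp C g f)"

locale category_functor =
  source: small_category C + target: small_category D
  for C :: "('o, 'm) category" and D :: "('p, 'n) category" +
  fixes Fo :: "'o \<Rightarrow> 'p" and Fm :: "'m \<Rightarrow> 'n"
  assumes Fo_in: "a \<in> Obj C \<Longrightarrow> Fo a \<in> Obj D"
    and Fm_in: "f \<in> Mor C \<Longrightarrow> Fm f \<in> Mor D"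
    and Fm_Dom: "f \<in> Mor C \<Longrightarrow> Dom D (Fm f) = Fo (Dom C f)"
    and Fm_Cod: "f \<in> Mor C \<Longrightarrow> Cod D (Fm f) = Fo (Cod C f)"
    and Fm_Id: "a \<in> Obj C \<Longrightarrow> Fm (Id C a) = Id D (Fo a)"
    and Fm_Comp: "\<lbrakk>f \<in> Mor C; g \<in> Mor C; Dom C g = Cod C f\<rbrakk>
      \<Longrightarrow> Fm (Comp C g f) = Comp D (Fm g) (Fm f)"

text \<open>
  Intended for \<open>R\<close> a congruence on the morphisms of \<open>C\<close>. Domain and codomain are constant on
  each class, and the union in \<open>Comp\<close> is then over copies of one and the same class.
\<close>

definition quotient_category ::
    "('o, 'm) category \<Rightarrow> ('m \<times> 'm) set \<Rightarrow> ('o, 'm set) category" where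
  "quotient_category C R =
    \<lparr> Obj = Obj C,
      Mor = Mor C // R,
      Dom = (\<lambda>X. the_elem (Dom C ` X)),
      Cod = (\<lambda>X. the_elem (Cod C ` X)),
      Id = (\<lambda>a. R `` {Id C a}),
      Comp = (\<lambda>X Y. \<Union>g\<in>X. \<Union>f\<in>Y. R `` {Comp C g f}) \<rparr>"


section \<open>Higher rank graphs\<close>

text \<open>
  Elements of $\mathbb{N}^k$ are functions on \<open>nat\<close> vanishing outside \<open>{1..k}\<close>; addition and
  zero are pointwise.
\<close>

definition Nk :: "nat \<Rightarrow> (nat \<Rightarrow> nat) set" where
  "Nk k = {n. \<forall>i. i \<notin> {1..k} \<longrightarrow> n i = 0}"

definition basis_vec :: "nat \<Rightarrow> nat \<Rightarrow> nat" where
  "basis_vec i = (\<lambda>j. if j = i then 1 else 0)"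

definition Nk_category :: "nat \<Rightarrow> (unit, nat \<Rightarrow> nat) category" where
  "Nk_category k =
    \<lparr> Obj = {()}, Mor = Nk k, Dom = (\<lambda>_. ()), Cod = (\<lambda>_. ()), Id = (\<lambda>_. 0), Comp = (+) \<rparr>"

definition degree_functor :: "nat \<Rightarrow> ('o, 'm) category \<Rightarrow> ('m \<Rightarrow> nat \<Rightarrow> nat) \<Rightarrow> bool" where
  "degree_functor k C d \<longleftrightarrow> category_functor C (Nk_category k) (\<lambda>_. ()) d"

text \<open>
  Since \<open>m\<close> and \<open>n\<close> range over all of $\mathbb{N}^k$ and addition is commutative, it does not
  matter whether the product \<open>\<mu>\<nu>\<close> is read as \<open>\<mu> \<circ> \<nu>\<close> (as here) or as \<open>\<nu> \<circ> \<mu>\<close>.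
\<close>

definition unique_factorisation :: "nat \<Rightarrow> ('o, 'm) category \<Rightarrow> ('m \<Rightarrow> nat \<Rightarrow> nat) \<Rightarrow> bool" where
  "unique_factorisation k C d \<longleftrightarrow>
    (\<forall>\<pi>\<in>Mor C. \<forall>m\<in>Nk k. \<forall>n\<in>Nk k. d \<pi> = m + n \<longrightarrow>
      (\<exists>!p. case p of (\<mu>, \<nu>) \<Rightarrow>
        \<mu> \<in> Mor C \<and> \<nu> \<in> Mor C \<and> Dom C \<mu> = Cod C \<nu> \<and>
        \<pi> = Comp C \<mu> \<nu> \<and> d \<mu> = m \<and> d \<nu> = n))"

definition k_graph :: "nat \<Rightarrow> ('o, 'm) category \<Rightarrow> ('m \<Rightarrow> nat \<Rightarrow> nat) \<Rightarrow> bool" where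
  "k_graph k C d \<longleftrightarrow>
    small_category C \<and> countable (Obj C) \<and> countable (Mor C) \<and>
    degree_functor k C d \<and> unique_factorisation k C d"


section \<open>Digraphs of dimension \<open>k\<close>\<close>

text \<open>
  The directed graph $(V,E,o,t)$ is \<open>G\<close>, with \<open>tail G\<close> the origin and \<open>head G\<close> the terminus
  map; \<open>E i\<close> is the set of edges of colour \<open>i\<close>, for \<open>i \<in> {1..k}\<close>. A path \<open>xy\<close> of length two
  is the pair \<open>(x, y)\<close>.
\<close>

definition bicoloured_paths ::
    "nat \<Rightarrow> ('v, 'e) pre_digraph \<Rightarrow> (nat \<Rightarrow> 'e set) \<Rightarrow> ('e \<times> 'e) set" where
  "bicoloured_paths k G E =
    {(x, y). head G x = tail G y \<and>
       (\<exists>i\<in>{1..k}. \<exists>j\<in>{1..k}. i \<noteq> j \<and> x \<in> E i \<and> y \<in> E j)}"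

definition flips ::
    "nat \<Rightarrow> ('v, 'e) pre_digraph \<Rightarrow> (nat \<Rightarrow> 'e set) \<Rightarrow> ('e \<times> 'e \<Rightarrow> 'e \<times> 'e)
      \<Rightarrow> 'e \<times> 'e \<Rightarrow> 'e \<times> 'e \<Rightarrow> bool" where
  "flips k G E \<phi> p q \<longleftrightarrow> p \<in> bicoloured_paths k G E \<and> \<phi> p = q"

locale k_dim_digraph = fin_digraph G
  for G :: "('v, 'e) pre_digraph" +
  fixes k :: nat
    and E :: "nat \<Rightarrow> 'e set"
    and \<phi> :: "'e \<times> 'e \<Rightarrow> 'e \<times> 'e"
  assumes two_le_k: "2 \<le> k"
    and arcs_eq: "arcs G = (\<Union>i\<in>{1..k}. E i)"
    and disjoint_colours: "disjoint_family_on E {1..k}"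
    and bij_flip: "bij_betw \<phi> (bicoloured_paths k G E) (bicoloured_paths k G E)"
    and F1_swap:
      "\<lbrakk>i \<in> {1..k}; j \<in> {1..k}; i \<noteq> j; x \<in> E i; y \<in> E j; (x, y) \<in> bicoloured_paths k G E\<rbrakk>
        \<Longrightarrow> \<exists>!p. case p of (y', x') \<Rightarrow> \<phi> (x, y) = (y', x') \<and> y' \<in> E j \<and> x' \<in> E i \<and>
              tail G y' = tail G x \<and> head G x' = head G y"
    and F1_invol: "p \<in> bicoloured_paths k G E \<Longrightarrow> \<phi> (\<phi> p) = p"
    and F2:
      "\<And>i j l x y z x\<^sub>1 x\<^sub>2 x1 x2 y\<^sub>1 y\<^sub>2 y1 y2 z\<^sub>1 z\<^sub>2 z1 z2.
        \<lbrakk>i \<in> {1..k}; j \<in> {1..k}; l \<in> {1..k}; i \<noteq> j; j \<noteq> l; i \<noteq> l;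
         x \<in> E i; y \<in> E j; z \<in> E l; head G x = tail G y; head G y = tail G z;
         {x\<^sub>1, x\<^sub>2, x1, x2} \<subseteq> E i; {y\<^sub>1, y\<^sub>2, y1, y2} \<subseteq> E j; {z\<^sub>1, z\<^sub>2, z1, z2} \<subseteq> E l;
         flips k G E \<phi> (x, y) (y1, x1); flips k G E \<phi> (x1, z) (z1, x2);
         flips k G E \<phi> (y1, z1) (z2, y2);
         flips k G E \<phi> (y, z) (z\<^sub>1, y\<^sub>1); flips k G E \<phi> (x, z\<^sub>1) (z\<^sub>2, x\<^sub>1);
         flips k G E \<phi> (x\<^sub>1, y\<^sub>1) (y\<^sub>2, x\<^sub>2)\<rbrakk>
        \<Longrightarrow> x\<^sub>2 = x2 \<and> y\<^sub>2 = y2 \<and> z\<^sub>2 = z2"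


section \<open>The category of a digraph of dimension \<open>k\<close>\<close>

text \<open>
  A directed path is a triple \<open>(u, p, v)\<close> of its origin, its list of edges in order of travel,
  and its terminus, so that the empty paths at distinct vertices are distinct. Composing in the
  order \<open>g \<circ> f\<close> means appending the edges of \<open>g\<close> after those of \<open>f\<close>.
\<close>

type_synonym ('v, 'e) dipath = "'v \<times> 'e list \<times> 'v"

definition dipaths :: "('v, 'e) pre_digraph \<Rightarrow> ('v, 'e) dipath set" where
  "dipaths G = {(u, p, v). pre_digraph.awalk G u p v}"

definition free_category :: "('v, 'e) pre_digraph \<Rightarrow> ('v, ('v, 'e) dipath) category" where
  "free_category G =
    \<lparr> Obj = verts G,
      Mor = dipaths G,
      Dom = (\<lambda>(u, p, v). u),
      Cod = (\<lambda>(u, p, v). v),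
      Id = (\<lambda>u. (u, [], u)),
      Comp = (\<lambda>(u', q, w) (u, p, v). (u, p @ q, w)) \<rparr>"

inductive flip_step ::
    "nat \<Rightarrow> ('v, 'e) pre_digraph \<Rightarrow> (nat \<Rightarrow> 'e set) \<Rightarrow> ('e \<times> 'e \<Rightarrow> 'e \<times> 'e)
      \<Rightarrow> ('v, 'e) dipath \<Rightarrow> ('v, 'e) dipath \<Rightarrow> bool"
  for k G E \<phi> where
  "flips k G E \<phi> (x, y) (y', x')
    \<Longrightarrow> flip_step k G E \<phi> (u, p @ [x, y] @ q, v) (u, p @ [y', x'] @ q, v)"

text \<open>
  No symmetric closure is needed: \<open>\<phi>\<close> is an involution in a \<open>k\<close>-dimensional digraph.
\<close>

definition path_equiv ::
    "nat \<Rightarrow> ('v, 'e) pre_digraph \<Rightarrow> (nat \<Rightarrow> 'e set) \<Rightarrow> ('e \<times> 'e \<Rightarrow> 'e \<times> 'e)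
      \<Rightarrow> (('v, 'e) dipath \<times> ('v, 'e) dipath) set" where
  "path_equiv k G E \<phi> =
    {(P, Q). P \<in> dipaths G \<and> Q \<in> dipaths G \<and> (flip_step k G E \<phi>)\<^sup>*\<^sup>* P Q}"

definition Lambda_DG ::
    "nat \<Rightarrow> ('v, 'e) pre_digraph \<Rightarrow> (nat \<Rightarrow> 'e set) \<Rightarrow> ('e \<times> 'e \<Rightarrow> 'e \<times> 'e)
      \<Rightarrow> ('v, ('v, 'e) dipath set) category" where
  "Lambda_DG k G E \<phi> = quotient_category (free_category G) (path_equiv k G E \<phi>)"

definition edge_morphism ::
    "nat \<Rightarrow> ('v, 'e) pre_digraph \<Rightarrow> (nat \<Rightarrow> 'e set) \<Rightarrow> ('e \<times> 'e \<Rightarrow> 'e \<times> 'e)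
      \<Rightarrow> 'e \<Rightarrow> ('v, 'e) dipath set" where
  "edge_morphism k G E \<phi> x = path_equiv k G E \<phi> `` {(tail G x, [x], head G x)}"

end

theory Submission
  imports Defs "HOL-Library.Multiset"
begin

text \<open>
  Flips allow the edges of a path to be sorted by colour, by insertion sort. The sorted path is
  invariant under flips: moving two edges of distinct colours past a third one, in either order,
  gives the same result, by \<open>\<phi>\<^sup>2 = 1\<close> or by (F2). For a given sequence of colours, insertion
  sort is injective since flips are. Hence equivalent paths with the same sequence of colours are
  equal. If \<open>qr\<close> and \<open>q'r'\<close> are equivalent with factors of the same degrees, sorting each factor
  separately gives equivalent paths with the same sequence of colours, which therefore coincide;
  this is uniqueness. For existence, any colour occurring in a path can be flipped to the front.
\<close>

section \<open>Quotients of categories by congruences\<close>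

text \<open>Related morphisms are parallel, so composability of \<open>g\<close> and
  \<open>f\<close> passes to \<open>g'\<close> and \<open>f'\<close>.\<close>

locale category_congruence = small_category C
  for C :: "('o, 'm) category" +
  fixes R :: "('m \<times> 'm) set"
  assumes equiv: "equiv (Mor C) R"
    and Dom_cong: "(f, f') \<in> R \<Longrightarrow> Dom C f = Dom C f'"
    and Cod_cong: "(f, f') \<in> R \<Longrightarrow> Cod C f = Cod C f'"
    and Comp_cong: "\<lbrakk>(g, g') \<in> R; (f, f') \<in> R; Dom C g = Cod C f\<rbrakk>
      \<Longrightarrow> (Comp C g f, Comp C g' f') \<in> R"
begin

lemma class_self: "f \<in> Mor C \<Longrightarrow> f \<in> R `` {f}"
  using equiv by (rule equiv_class_self)

text \<open>Serves all quantities defined by \<open>the_elem\<close> on a class: \<open>Dom\<close>,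
  \<open>Cod\<close> and later \<open>degree\<close>. The image of the class is a singleton,
  nonempty because the class contains \<open>f\<close>.\<close>

lemma the_elem_class:
  assumes f: "f \<in> Mor C" and h: "\<And>g. (f, g) \<in> R \<Longrightarrow> h g = h f"
  shows "the_elem (h ` (R `` {f})) = h f"
proof -
  have "h ` (R `` {f}) = {h f}"
    using class_self[OF f] by (force dest: h)
  then show ?thesis by simp
qed

lemma Obj_quotient [simp]: "Obj (quotient_category C R) = Obj C"
  by (simp add: quotient_category_def)

lemma Mor_quotient: "Mor (quotient_category C R) = Mor C // R"
  by (simp add: quotient_category_def)

lemma class_in_quotient: "f \<in> Mor C \<Longrightarrow> R `` {f} \<in> Mor (quotient_category C R)"
  by (simp add: Mor_quotient quotientI)

lemma Dom_class: "f \<in> Mor C \<Longrightarrow> Dom (quotient_category C R) (R `` {f}) = Dom C f"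
  using the_elem_class[of f "Dom C"] Dom_cong by (auto simp: quotient_category_def)

lemma Cod_class: "f \<in> Mor C \<Longrightarrow> Cod (quotient_category C R) (R `` {f}) = Cod C f"
  using the_elem_class[of f "Cod C"] Cod_cong by (auto simp: quotient_category_def)

lemma Id_quotient: "Id (quotient_category C R) a = R `` {Id C a}"
  by (simp add: quotient_category_def)

lemma Comp_class:
  assumes "f \<in> Mor C" "g \<in> Mor C" "Dom C g = Cod C f"
  shows "Comp (quotient_category C R) (R `` {g}) (R `` {f}) = R `` {Comp C g f}"
proof -
  have "R `` {Comp C g' f'} = R `` {Comp C g f}" if "(g, g') \<in> R" "(f, f') \<in> R" for g' f'
    using equiv_class_eq[OF equiv Comp_cong[OF that assms(3)]] by simp
  \<comment> \<open>Reflexivity makes both index sets nonempty, so the union of equal classes is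
    that class and not the empty set.\<close>
  then have "(\<Union>g'\<in>R `` {g}. \<Union>f'\<in>R `` {f}. R `` {Comp C g' f'}) = R `` {Comp C g f}"
    using class_self[OF assms(1)] class_self[OF assms(2)] by blast
  then show ?thesis by (simp add: quotient_category_def)
qed

lemma quotient_cases:
  assumes "X \<in> Mor (quotient_category C R)"
  obtains f where "f \<in> Mor C" "X = R `` {f}"
  using assms by (auto simp: Mor_quotient elim: quotientE)

sublocale quotient: small_category "quotient_category C R"
proof
  fix X Y Z
  assume X: "X \<in> Mor (quotient_category C R)"
  then obtain f where f: "f \<in> Mor C" "X = R `` {f}" by (rule quotient_cases)
  show "Dom (quotient_category C R) X \<in> Obj (quotient_category C R)"
    "Cod (quotient_category C R) X \<in> Obj (quotient_category C R)"
    using f by (simp_all add: Dom_class Cod_class Dom_in Cod_in)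
  show "Comp (quotient_category C R) X
      (Id (quotient_category C R) (Dom (quotient_category C R) X)) = X"
    "Comp (quotient_category C R)
      (Id (quotient_category C R) (Cod (quotient_category C R) X)) X = X"
    using f by (simp_all add: Dom_class Cod_class Id_quotient Comp_class Dom_in Cod_in
        Id_in Dom_Id Cod_Id Comp_Id Id_Comp)
  assume "Y \<in> Mor (quotient_category C R)"
    and XY: "Dom (quotient_category C R) Y = Cod (quotient_category C R) X"
  then obtain g where g: "g \<in> Mor C" "Y = R `` {g}" by (auto elim: quotient_cases)
  have fg: "Dom C g = Cod C f"
    using XY f g by (simp add: Dom_class Cod_class)
  show "Comp (quotient_category C R) Y X \<in> Mor (quotient_category C R)"
    "Dom (quotient_category C R) (Comp (quotient_category C R) Y X) =
      Dom (quotient_category C R) X"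
    "Cod (quotient_category C R) (Comp (quotient_category C R) Y X) =
      Cod (quotient_category C R) Y"
    using f g fg by (simp_all add: Comp_class Comp_in class_in_quotient Dom_class Cod_class
        Dom_Comp Cod_Comp)
  assume "Z \<in> Mor (quotient_category C R)"
    and YZ: "Dom (quotient_category C R) Z = Cod (quotient_category C R) Y"
  then obtain h where h: "h \<in> Mor C" "Z = R `` {h}" by (auto elim: quotient_cases)
  have gh: "Dom C h = Cod C g"
    using YZ g h by (simp add: Dom_class Cod_class)
  show "Comp (quotient_category C R) (Comp (quotient_category C R) Z Y) X =
      Comp (quotient_category C R) Z (Comp (quotient_category C R) Y X)"
    using f g h fg gh by (simp add: Comp_class Comp_in Dom_Comp Cod_Comp Comp_assoc)
qed (simp_all add: Id_quotient class_in_quotient Id_in Dom_class Cod_class Dom_Id Cod_Id)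

end

section \<open>The target monoid and the free category\<close>

lemma small_category_Nk: "small_category (Nk_category k)"
  by unfold_locales (auto simp: Nk_category_def Nk_def add.assoc)

text \<open>Finite support allows a degree vector to be read as a multiset of colours through
  \<open>Abs_multiset\<close>.\<close>

lemma finite_support_Nk: "m \<in> Nk k \<Longrightarrow> finite {i. 0 < m i}"
  by (rule finite_subset[of _ "{1..k}"]) (auto simp: Nk_def intro: ccontr)

lemma (in wf_digraph) small_category_free: "small_category (free_category G)"
  by unfold_locales
    (auto simp: free_category_def dipaths_def awalk_Nil_iff awalk_hd_in_verts
      awalk_last_in_verts)

section \<open>Colours and single flips\<close>

context k_dim_digraph
begin

lemma E_arcs: "i \<in> {1..k} \<Longrightarrow> x \<in> E i \<Longrightarrow> x \<in> arcs G"
  using arcs_eq by blast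

text \<open>Disjointness of the colour classes determines the value on \<open>arcs G\<close>;
  elsewhere it is unspecified.\<close>

definition colour :: "'e \<Rightarrow> nat" where
  "colour x = (THE i. i \<in> {1..k} \<and> x \<in> E i)"

lemma colour_eq:
  assumes "i \<in> {1..k}" "x \<in> E i"
  shows "colour x = i"
  unfolding colour_def
proof (rule the_equality)
  fix j assume "j \<in> {1..k} \<and> x \<in> E j"
  with assms disjoint_family_onD[OF disjoint_colours, of i j] show "j = i" by blast
qed (use assms in blast)

lemma colour_arc: "x \<in> arcs G \<Longrightarrow> colour x \<in> {1..k} \<and> x \<in> E (colour x)"
  using arcs_eq colour_eq by auto

lemma bicoloured_iff:
  "(x, y) \<in> bicoloured_paths k G E \<longleftrightarrow>
    x \<in> arcs G \<and> y \<in> arcs G \<and> head G x = tail G y \<and> colour x \<noteq> colour y"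
proof
  assume "(x, y) \<in> bicoloured_paths k G E"
  then show "x \<in> arcs G \<and> y \<in> arcs G \<and> head G x = tail G y \<and> colour x \<noteq> colour y"
    unfolding bicoloured_paths_def using colour_eq E_arcs by auto
next
  assume "x \<in> arcs G \<and> y \<in> arcs G \<and> head G x = tail G y \<and> colour x \<noteq> colour y"
  then show "(x, y) \<in> bicoloured_paths k G E"
    unfolding bicoloured_paths_def using colour_arc by blast
qed

text \<open>Bundles \<open>F1_swap\<close>, \<open>F1_invol\<close> and \<open>bij_flip\<close>: a
  flip exchanges the order of the colours, keeps both ends, may change the middle vertex, and is
  undone by a second flip.\<close>

lemma flip_cases:
  assumes "(x, y) \<in> bicoloured_paths k G E"
  obtains y' x' where "\<phi> (x, y) = (y', x')" "\<phi> (y', x') = (x, y)"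
    "(y', x') \<in> bicoloured_paths k G E" "colour y' = colour y" "colour x' = colour x"
    "tail G y' = tail G x" "head G x' = head G y"
proof -
  have xy: "x \<in> arcs G" "y \<in> arcs G" "colour x \<noteq> colour y"
    using assms by (auto simp: bicoloured_iff)
  obtain y' x' where *: "\<phi> (x, y) = (y', x')" "y' \<in> E (colour y)" "x' \<in> E (colour x)"
    "tail G y' = tail G x" "head G x' = head G y"
    using F1_swap[of "colour x" "colour y" x y] xy colour_arc[of x] colour_arc[of y] assms
    by (auto simp: Ex1_def)
  moreover have "(y', x') \<in> bicoloured_paths k G E"
    using bij_betwE[OF bij_flip] assms *(1) by metis
  moreover have "\<phi> (y', x') = (x, y)"
    using F1_invol[OF assms] *(1) by simp
  ultimately show ?thesis
    using that colour_eq colour_arc xy by blast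
qed

abbreviation colours :: "'e list \<Rightarrow> nat list" where
  "colours \<equiv> map colour"

lemma flip_step_cases:
  assumes "flip_step k G E \<phi> (u, p, v) Q"
  obtains a x y b y' x' where "p = a @ [x, y] @ b" "Q = (u, a @ [y', x'] @ b, v)"
    "(x, y) \<in> bicoloured_paths k G E" "\<phi> (x, y) = (y', x')"
  using assms by (auto simp: flips_def elim!: flip_step.cases)

lemma flip_step_colours:
  assumes "flip_step k G E \<phi> (u, p, v) (u', q, v')"
  shows "mset (colours q) = mset (colours p)"
  using assms
proof (rule flip_step_cases)
  fix a x y b y' x'
  assume *: "p = a @ [x, y] @ b" "(u', q, v') = (u, a @ [y', x'] @ b, v)"
    "(x, y) \<in> bicoloured_paths k G E" "\<phi> (x, y) = (y', x')"
  from *(3) show ?thesis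
    by (rule flip_cases) (use * in auto)
qed

text \<open>Only the vertex between the two flipped edges can change, and the flipped pair is again
  composable there.\<close>

lemma flip_step_awalk:
  assumes "flip_step k G E \<phi> (u, p, v) (u', q, v')" "awalk u p v"
  shows "awalk u q v"
  using assms(1)
proof (rule flip_step_cases)
  fix a x y b y' x'
  assume *: "p = a @ [x, y] @ b" "(u', q, v') = (u, a @ [y', x'] @ b, v)"
    "(x, y) \<in> bicoloured_paths k G E" "\<phi> (x, y) = (y', x')"
  from *(3) show ?thesis
    by (rule flip_cases)
      (use * assms(2) in \<open>auto simp: awalk_append_iff awalk_Cons_iff bicoloured_iff\<close>)
qed

text \<open>Flipping again at the same position restores the path, since \<open>\<phi>\<close> is
  involutive.\<close>

lemma flip_step_sym:
  assumes "flip_step k G E \<phi> P Q"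
  shows "flip_step k G E \<phi> Q P"
  using assms
proof (cases rule: flip_step.cases)
  case (1 x y y' x' u p q v)
  from 1(3) have xy: "(x, y) \<in> bicoloured_paths k G E" and f: "\<phi> (x, y) = (y', x')"
    by (auto simp: flips_def)
  from xy have "flips k G E \<phi> (y', x') (x, y)"
    by (rule flip_cases) (use f in \<open>auto simp: flips_def\<close>)
  then show ?thesis unfolding 1 by (rule flip_step.intros)
qed

text \<open>A step copies the recorded end vertices without testing them, so the larger path may
  carry any \<open>s\<close> and \<open>t\<close>.\<close>

lemma flip_step_context:
  assumes "flip_step k G E \<phi> (u, p, v) (u', q, v')"
  shows "u' = u \<and> v' = v \<and> flip_step k G E \<phi> (s, a @ p @ b, t) (s, a @ q @ b, t)"
  using assms
proof (cases rule: flip_step.cases)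
  case (1 x y y' x' c d)
  then show ?thesis
    using flip_step.intros[OF 1(5), of s "a @ c" "d @ b" t] by simp
qed

lemma flip_steps_context:
  assumes "(flip_step k G E \<phi>)\<^sup>*\<^sup>* (u, p, v) (u', q, v')"
  shows "u' = u \<and> v' = v \<and> (flip_step k G E \<phi>)\<^sup>*\<^sup>* (s, a @ p @ b, t) (s, a @ q @ b, t)"
  using assms
proof (induction "(u', q, v')" arbitrary: u' q v' rule: rtranclp_induct)
  case (step Q)
  obtain u1 q1 v1 where "Q = (u1, q1, v1)" by (cases Q)
  with step show ?case
    using flip_step_context[of u1 q1 v1 u' q v' s a b t] by (metis rtranclp.rtrancl_into_rtrancl)
qed simp

section \<open>The congruence generated by flips\<close>

abbreviation path_sim :: "'v \<Rightarrow> 'v \<Rightarrow> 'e list \<Rightarrow> 'e list \<Rightarrow> bool" where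
  "path_sim u v p q \<equiv> ((u, p, v), (u, q, v)) \<in> path_equiv k G E \<phi>"

lemma equiv_path_equiv: "equiv (dipaths G) (path_equiv k G E \<phi>)"
proof (rule equivI)
  have "symp (flip_step k G E \<phi>)\<^sup>*\<^sup>*"
    by (rule symp_rtranclp, rule sympI) (rule flip_step_sym)
  then show "sym (path_equiv k G E \<phi>)"
    unfolding sym_def path_equiv_def by (blast dest: sympD)
  show "trans (path_equiv k G E \<phi>)"
    unfolding trans_def path_equiv_def by (blast intro: rtranclp_trans)
qed (auto simp: path_equiv_def refl_on_def)

lemma path_equiv_ends:
  "((u, p, v), (u', q, v')) \<in> path_equiv k G E \<phi> \<Longrightarrow>
    u' = u \<and> v' = v \<and> awalk u p v \<and> awalk u q v"
  using flip_steps_context[of u p v u' q v'] by (auto simp: path_equiv_def dipaths_def)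

lemma path_sim_refl: "awalk u p v \<Longrightarrow> path_sim u v p p"
  by (simp add: path_equiv_def dipaths_def)

lemma path_sim_sym: "path_sim u v p q \<Longrightarrow> path_sim u v q p"
  using equiv_path_equiv by (meson equivE symD)

lemma path_sim_trans [trans]:
  "path_sim u v p q \<Longrightarrow> path_sim u v q r \<Longrightarrow> path_sim u v p r"
  using equiv_path_equiv by (meson equivE transD)

text \<open>Rewrite the first factor in front of \<open>q\<close>, then the second factor behind
  \<open>p'\<close>.\<close>

lemma path_sim_append:
  assumes "path_sim u w p p'" "path_sim w v q q'"
  shows "path_sim u v (p @ q) (p' @ q')"
proof -
  have "awalk u (p @ q) v" "awalk u (p' @ q') v"
    using assms path_equiv_ends by (metis awalk_appendI)+
  moreover have "(flip_step k G E \<phi>)\<^sup>*\<^sup>* (u, p @ q, v) (u, p' @ q, v)"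
    using assms(1) flip_steps_context[of u p w u p' w u "[]" q v] by (simp add: path_equiv_def)
  moreover have "(flip_step k G E \<phi>)\<^sup>*\<^sup>* (u, p' @ q, v) (u, p' @ q', v)"
    using assms(2) flip_steps_context[of w q v w q' v u p' "[]" v] by (simp add: path_equiv_def)
  ultimately show ?thesis
    by (auto simp: path_equiv_def dipaths_def)
qed

lemma path_sim_Cons:
  assumes "x \<in> arcs G" "path_sim (head G x) v p q"
  shows "path_sim (tail G x) v (x # p) (x # q)"
  using path_sim_append[OF path_sim_refl[OF arc_implies_awalk[OF assms(1)]] assms(2)] by simp

lemma path_sim_flip:
  assumes "awalk u (x # y # p) v" "colour x \<noteq> colour y" "\<phi> (x, y) = (y', x')"
  shows "path_sim u v (x # y # p) (y' # x' # p)"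
proof -
  have "flips k G E \<phi> (x, y) (y', x')"
    using assms by (auto simp: flips_def bicoloured_iff awalk_Cons_iff)
  from flip_step.intros[OF this, of u "[]" p v]
  have "flip_step k G E \<phi> (u, x # y # p, v) (u, y' # x' # p, v)" by simp
  with assms(1) show ?thesis
    by (auto simp: path_equiv_def dipaths_def dest: flip_step_awalk)
qed

text \<open>A flip only permutes the colour sequence. This makes the degree well defined on
  classes.\<close>

lemma path_sim_colours:
  assumes "path_sim u v p q"
  shows "mset (colours q) = mset (colours p)"
proof -
  have "(flip_step k G E \<phi>)\<^sup>*\<^sup>* (u, p, v) (u', q, v') \<Longrightarrow> ?thesis" for u' v'
  proof (induction "(u', q, v')" arbitrary: u' q v' rule: rtranclp_induct)
    case (step Q)
    obtain u1 q1 v1 where "Q = (u1, q1, v1)" by (cases Q)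
    with step show ?case using flip_step_colours by metis
  qed simp
  with assms show ?thesis by (auto simp: path_equiv_def)
qed

section \<open>Sorting by colour and its invariance under flips\<close>

text \<open>The inserted edge moves right by flips past edges of strictly smaller colour. Each flip
  replaces both edges, so the recursion carries on with \<open>x'\<close>. Equal colours stop the
  insertion: \<open>\<phi>\<close> is meaningful on distinct colours only.\<close>

fun ins :: "'e \<Rightarrow> 'e list \<Rightarrow> 'e list" where
  "ins x [] = [x]"
| "ins x (y # p) = (if colour x \<le> colour y then x # y # p
     else (case \<phi> (x, y) of (y', x') \<Rightarrow> y' # ins x' p))"

text \<open>A canonical representative of the class of a walk: it lies in the class by
  \<open>path_sim_colour_sort\<close> and is constant on the class by
  \<open>path_sim_imp_colour_sort_eq\<close>.\<close>

definition colour_sort :: "'e list \<Rightarrow> 'e list" where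
  "colour_sort p = foldr ins p []"

lemma colour_sort_simps [simp]:
  "colour_sort [] = []"
  "colour_sort (x # p) = ins x (colour_sort p)"
  by (simp_all add: colour_sort_def)

text \<open>Each recursive call of \<open>ins\<close> is one flip, at a pair that is bicoloured
  because the first colour is strictly larger.\<close>

lemma path_sim_ins: "awalk u (x # p) v \<Longrightarrow> path_sim u v (x # p) (ins x p)"
proof (induction x p arbitrary: u rule: ins.induct)
  case (2 x y p)
  show ?case
  proof (cases "colour x \<le> colour y")
    case True
    with 2 show ?thesis by (simp add: path_sim_refl)
  next
    case False
    with 2(2) have xy: "(x, y) \<in> bicoloured_paths k G E"
      by (auto simp: bicoloured_iff awalk_Cons_iff)
    then obtain y' x' where f: "\<phi> (x, y) = (y', x')" "(y', x') \<in> bicoloured_paths k G E"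
      by (rule flip_cases)
    have s: "path_sim u v (x # y # p) (y' # x' # p)"
      using path_sim_flip[OF 2(2) _ f(1)] False by auto
    then have "awalk u (y' # x' # p) v" using path_equiv_ends by blast
    then have w: "y' \<in> arcs G" "u = tail G y'" "awalk (head G y') (x' # p) v"
      by (auto simp: awalk_Cons_iff)
    have "path_sim u v (y' # x' # p) (y' # ins x' p)"
      using path_sim_Cons[OF w(1) 2(1)[OF False f(1)[symmetric] w(3)]] w(2) by simp
    with s have "path_sim u v (x # y # p) (y' # ins x' p)" by (rule path_sim_trans)
    with False f show ?thesis by simp
  qed
qed (simp add: path_sim_refl)

lemma path_sim_colour_sort: "awalk u p v \<Longrightarrow> path_sim u v p (colour_sort p)"
proof (induction p arbitrary: u)
  case (Cons x p)
  then have x: "x \<in> arcs G" "u = tail G x" "path_sim (head G x) v p (colour_sort p)"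
    by (auto simp: awalk_Cons_iff)
  then have s: "path_sim u v (x # p) (x # colour_sort p)"
    using path_sim_Cons by blast
  then have "path_sim u v (x # colour_sort p) (ins x (colour_sort p))"
    using path_sim_ins path_equiv_ends by blast
  with s show ?case by (auto intro: path_sim_trans)
qed (simp add: path_sim_refl)

lemma awalk_colour_sort: "awalk u p v \<Longrightarrow> awalk u (colour_sort p) v"
  using path_sim_colour_sort path_equiv_ends by blast

text \<open>Edges keep their colours under flips, so on colour sequences \<open>ins\<close> is
  ordinary insertion. The walk hypothesis ensures that every pair met is one on which
  \<open>\<phi>\<close> behaves as a flip.\<close>

lemma colours_ins:
  "awalk u (x # p) v \<Longrightarrow> colours (ins x p) = insort (colour x) (colours p)"
proof (induction x p arbitrary: u rule: ins.induct)
  case (2 x y p)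
  show ?case
  proof (cases "colour x \<le> colour y")
    case False
    with 2(2) have xy: "(x, y) \<in> bicoloured_paths k G E"
      by (auto simp: bicoloured_iff awalk_Cons_iff)
    then obtain y' x' where f: "\<phi> (x, y) = (y', x')" "(y', x') \<in> bicoloured_paths k G E"
      "colour y' = colour y" "colour x' = colour x" "head G x' = head G y"
      by (rule flip_cases)
    then have "awalk (tail G x') (x' # p) v"
      using 2(2) by (auto simp: awalk_Cons_iff bicoloured_iff)
    from 2(1)[OF False f(1)[symmetric] this] False f show ?thesis by simp
  qed simp
qed simp

text \<open>Hence the sorted colour sequence depends only on the multiset of colours, that is, on
  the degree.\<close>

lemma colours_colour_sort: "awalk u p v \<Longrightarrow> colours (colour_sort p) = sort (colours p)"
proof (induction p arbitrary: u)
  case (Cons x p)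
  then have "awalk u (x # colour_sort p) v"
    by (auto simp: awalk_Cons_iff awalk_colour_sort)
  with Cons show ?case
    by (auto simp: colours_ins awalk_Cons_iff)
qed simp

text \<open>
  If \<open>z\<close> is the head of \<open>p\<close>, the cases are those of the colour of \<open>z\<close> relative to the colours of
  \<open>x\<close> and \<open>y\<close>. Only when it lies below both is (F2) needed; otherwise \<open>\<phi>\<^sup>2 = 1\<close> suffices.
\<close>

lemma ins_flip_less:
  "\<lbrakk>awalk u (x # y # p) v; colour x < colour y; \<phi> (x, y) = (y', x')\<rbrakk>
    \<Longrightarrow> ins x (ins y p) = ins y' (ins x' p)"
proof (induction p arbitrary: u x y y' x')
  case Nil
  then have "(x, y) \<in> bicoloured_paths k G E"
    by (auto simp: bicoloured_iff awalk_Cons_iff)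
  then show ?case
    by (rule flip_cases) (use Nil in auto)
next
  case (Cons z p)
  have xy: "(x, y) \<in> bicoloured_paths k G E"
    using Cons.prems by (auto simp: bicoloured_iff awalk_Cons_iff)
  have f: "\<phi> (y', x') = (x, y)" "(y', x') \<in> bicoloured_paths k G E"
    "colour y' = colour y" "colour x' = colour x" "tail G y' = tail G x" "head G x' = head G y"
    using flip_cases[OF xy] Cons.prems(3) by (metis prod.inject)+
  have w: "x \<in> arcs G" "y \<in> arcs G" "z \<in> arcs G" "head G x = tail G y" "head G y = tail G z"
    "awalk (head G z) p v"
    using Cons.prems(1) by (auto simp: awalk_Cons_iff)
  show ?case
  proof (cases "colour x \<le> colour z")
    case xz: True
    show ?thesis
    proof (cases "colour y \<le> colour z")
      case True
      with xz Cons.prems f show ?thesis by simp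
    next
      case False
      \<comment> \<open>Both sides become \<open>x # ins y (z # p)\<close>: on the left
        \<open>x\<close> stops at \<open>z1\<close>, which has the colour of \<open>z\<close>; on
        the right \<open>y'\<close> flips back past \<open>x'\<close> and continues as
        \<open>y\<close>.\<close>
      with w have "(y, z) \<in> bicoloured_paths k G E"
        by (auto simp: bicoloured_iff)
      then obtain z1 y1 where "\<phi> (y, z) = (z1, y1)" "colour z1 = colour z"
        by (rule flip_cases)
      with False xz Cons.prems f show ?thesis by simp
    qed
  next
    case False
    \<comment> \<open>Now \<open>z\<close> has the smallest colour. The triple \<open>x\<close>,
      \<open>y\<close>, \<open>z\<close> is reversed along two routes of three flips: one moves
      \<open>z\<close> to the front first, the other starts with the flip of \<open>x\<close> and
      \<open>y\<close>.\<close>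
    have yz: "(y, z) \<in> bicoloured_paths k G E"
      using w False Cons.prems by (auto simp: bicoloured_iff)
    then obtain z1 y1 where g: "\<phi> (y, z) = (z1, y1)" "(z1, y1) \<in> bicoloured_paths k G E"
      "colour z1 = colour z" "colour y1 = colour y" "tail G z1 = tail G y" "head G y1 = head G z"
      by (rule flip_cases)
    have xz1: "(x, z1) \<in> bicoloured_paths k G E"
      using w False g by (auto simp: bicoloured_iff)
    then obtain z2 x1 where h: "\<phi> (x, z1) = (z2, x1)" "(z2, x1) \<in> bicoloured_paths k G E"
      "colour z2 = colour z" "colour x1 = colour x" "tail G z2 = tail G x" "head G x1 = head G z1"
      using g(3) by (metis flip_cases)
    have x1y1: "(x1, y1) \<in> bicoloured_paths k G E"
      using w False g h Cons.prems by (auto simp: bicoloured_iff)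
    then obtain y2 x2 where i: "\<phi> (x1, y1) = (y2, x2)" "(y2, x2) \<in> bicoloured_paths k G E"
      "colour y2 = colour y" "colour x2 = colour x"
      using g(4) h(4) by (metis flip_cases)
    have x'z: "(x', z) \<in> bicoloured_paths k G E"
      using w False f by (auto simp: bicoloured_iff)
    then obtain z1' x2' where g': "\<phi> (x', z) = (z1', x2')" "(z1', x2') \<in> bicoloured_paths k G E"
      "colour z1' = colour z" "colour x2' = colour x" "tail G z1' = tail G x'"
      using f(4) by (metis flip_cases)
    have y'z1': "(y', z1') \<in> bicoloured_paths k G E"
      using w False f g' Cons.prems by (auto simp: bicoloured_iff)
    then obtain z2' y2' where h': "\<phi> (y', z1') = (z2', y2')" "(z2', y2') \<in> bicoloured_paths k G E"
      "colour z2' = colour z" "colour y2' = colour y"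
      using f(3) g'(3) by (metis flip_cases)
    have E: "a \<in> E c" if "a \<in> arcs G" "colour a = c" for a c
      using that colour_arc by blast
    \<comment> \<open>The subscripted edges of \<open>F2\<close> are \<open>x1\<close>,
      \<open>y1\<close>, \<open>z1\<close>, \<open>x2\<close>, \<open>y2\<close>, \<open>z2\<close>;
      the superscripted ones are \<open>x'\<close>, \<open>y'\<close>, \<open>z1'\<close>,
      \<open>x2'\<close>, \<open>y2'\<close>, \<open>z2'\<close>.\<close>
    have "x2 = x2' \<and> y2 = y2' \<and> z2 = z2'"
    proof (rule F2)
      show "colour x \<in> {1..k}" "colour y \<in> {1..k}" "colour z \<in> {1..k}"
        using w colour_arc by blast+
      show "colour x \<noteq> colour y" "colour y \<noteq> colour z" "colour x \<noteq> colour z"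
        using False Cons.prems by auto
      show "{x1, x2, x', x2'} \<subseteq> E (colour x)" "{y1, y2, y', y2'} \<subseteq> E (colour y)"
        "{z1, z2, z1', z2'} \<subseteq> E (colour z)"
        using f g h i g' h' by (auto simp: bicoloured_iff intro: E)
      show "flips k G E \<phi> (x, y) (y', x')" "flips k G E \<phi> (x', z) (z1', x2')"
        "flips k G E \<phi> (y', z1') (z2', y2')" "flips k G E \<phi> (y, z) (z1, y1)"
        "flips k G E \<phi> (x, z1) (z2, x1)" "flips k G E \<phi> (x1, y1) (y2, x2)"
        using xy x'z y'z1' yz xz1 x1y1 Cons.prems g h i g' h' by (auto simp: flips_def)
    qed (use w in \<open>auto intro: E\<close>)
    \<comment> \<open>Behind the common head \<open>z2\<close> remains the same claim for the pair
      \<open>x1\<close>, \<open>y1\<close> and the shorter list \<open>p\<close>.\<close>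
    moreover have "ins x1 (ins y1 p) = ins y2 (ins x2 p)"
    proof (rule Cons.IH[OF _ _ i(1)])
      show "awalk (tail G x1) (x1 # y1 # p) v"
        using x1y1 g w by (auto simp: awalk_Cons_iff bicoloured_iff)
      show "colour x1 < colour y1" using g h Cons.prems by simp
    qed
    ultimately show ?thesis
      using False Cons.prems f g h g' h' by simp
  qed
qed

text \<open>If the first colour is the larger one, the flipped pair satisfies
  \<open>ins_flip_less\<close>, and its flip is the original pair; the equation is then read
  backwards.\<close>

lemma ins_flip:
  assumes "awalk u (x # y # p) v" "colour x \<noteq> colour y" "\<phi> (x, y) = (y', x')"
  shows "ins x (ins y p) = ins y' (ins x' p)"
proof (cases "colour x < colour y")
  case True
  with assms show ?thesis by (intro ins_flip_less)
next
  case False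
  have "(x, y) \<in> bicoloured_paths k G E"
    using assms by (auto simp: bicoloured_iff awalk_Cons_iff)
  then have f: "\<phi> (y', x') = (x, y)" "(y', x') \<in> bicoloured_paths k G E"
    "colour y' = colour y" "colour x' = colour x" "tail G y' = tail G x" "head G x' = head G y"
    using assms(3) by (metis flip_cases prod.inject)+
  have "awalk u (y' # x' # p) v"
    using path_sim_flip[OF assms] path_equiv_ends by blast
  from ins_flip_less[OF this _ f(1)] show ?thesis
    using False assms f by simp
qed

text \<open>Sorting works from the right: \<open>b\<close> is sorted already when the flipped pair
  is inserted, \<open>ins_flip\<close> equates the two results, and the same prefix \<open>a\<close>
  is inserted afterwards.\<close>

lemma colour_sort_flip_step:
  assumes "flip_step k G E \<phi> (u, p, v) (u', q, v')" "awalk u p v"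
  shows "colour_sort p = colour_sort q"
  using assms(1)
proof (rule flip_step_cases)
  fix a x y b y' x'
  assume *: "p = a @ [x, y] @ b" "(u', q, v') = (u, a @ [y', x'] @ b, v)"
    "(x, y) \<in> bicoloured_paths k G E" "\<phi> (x, y) = (y', x')"
  have "awalk (tail G x) (x # y # colour_sort b) v"
    using assms(2) * by (auto simp: awalk_append_iff awalk_Cons_iff intro: awalk_colour_sort)
  then have "ins x (ins y (colour_sort b)) = ins y' (ins x' (colour_sort b))"
    using ins_flip * by (auto simp: bicoloured_iff)
  with * show ?thesis by (simp add: colour_sort_def)
qed

lemma path_sim_imp_colour_sort_eq:
  assumes "path_sim u v p q"
  shows "colour_sort p = colour_sort q"
proof -
  \<comment> \<open>The walk property is carried along the steps because invariance is available for
    walks.\<close>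
  have "(flip_step k G E \<phi>)\<^sup>*\<^sup>* (u, p, v) (u', q, v') \<Longrightarrow> awalk u p v \<Longrightarrow>
    awalk u q v \<and> colour_sort p = colour_sort q" for u' v'
  proof (induction "(u', q, v')" arbitrary: u' q v' rule: rtranclp_induct)
    case (step Q)
    obtain u1 q1 v1 where Q: "Q = (u1, q1, v1)" by (cases Q)
    with step(1) have "u1 = u" "v1 = v" using flip_steps_context[of u p v u1 q1 v1] by simp_all
    with step(2) Q have f: "flip_step k G E \<phi> (u, q1, v) (u', q, v')" by simp
    from step(3)[OF Q step(4)] have "awalk u q1 v" "colour_sort p = colour_sort q1" by simp_all
    with f show ?case
      using colour_sort_flip_step[OF f] flip_step_awalk[OF f] by simp
  qed simp
  with assms show ?thesis by (auto simp: path_equiv_def dipaths_def)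
qed

section \<open>Injectivity of sorting for a fixed colour sequence\<close>

text \<open>Equal colour sequences force both insertions through the same branches, and every flip
  made on the way can be undone.\<close>

lemma ins_inject:
  assumes "awalk u (x # p) v" "awalk u' (y # q) v'" "colours (x # p) = colours (y # q)"
    "ins x p = ins y q"
  shows "x # p = y # q"
  using assms
proof (induction x p arbitrary: u u' y q rule: ins.induct)
  case (1 x)
  then show ?case by simp
next
  case (2 x z p)
  from 2(4) obtain z' q' where q: "q = z' # q'" by (cases q) auto
  show ?case
  proof (cases "colour x \<le> colour z")
    case True
    with 2 q show ?thesis by simp
  next
    case False
    have c: "colour y = colour x" "colour z' = colour z" "colours p = colours q'"
      using 2(4) q by auto
    have xz: "(x, z) \<in> bicoloured_paths k G E"
      using 2(2) False by (auto simp: bicoloured_iff awalk_Cons_iff)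
    then obtain z1 x1 where f: "\<phi> (x, z) = (z1, x1)" "\<phi> (z1, x1) = (x, z)"
      "(z1, x1) \<in> bicoloured_paths k G E" "colour x1 = colour x" "head G x1 = head G z"
      by (rule flip_cases)
    have yz: "(y, z') \<in> bicoloured_paths k G E"
      using 2(3) q c False by (auto simp: bicoloured_iff awalk_Cons_iff)
    then obtain z2 y2 where g: "\<phi> (y, z') = (z2, y2)" "\<phi> (z2, y2) = (y, z')"
      "(z2, y2) \<in> bicoloured_paths k G E" "colour y2 = colour y" "head G y2 = head G z'"
      by (rule flip_cases)
    have e: "z1 = z2" "ins x1 p = ins y2 q'"
      using 2(5) q c False f g by auto
    \<comment> \<open>Once \<open>x1 = y2\<close> is known, \<open>\<phi>\<close> maps
      \<open>(z1, x1) = (z2, y2)\<close> back to both \<open>(x, z)\<close> and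
      \<open>(y, z')\<close>.\<close>
    have "x1 # p = y2 # q'"
    proof (rule 2(1)[OF False f(1)[symmetric] _ _ _ e(2)])
      show "awalk (tail G x1) (x1 # p) v" "awalk (tail G y2) (y2 # q') v'"
        using 2(2,3) q f g by (auto simp: awalk_Cons_iff bicoloured_iff)
      show "colours (x1 # p) = colours (y2 # q')" using c f g by simp
    qed
    with e f g q show ?thesis by auto
  qed
qed

lemma colour_sort_inject:
  assumes "awalk u p v" "awalk u' q v'" "colours p = colours q" "colour_sort p = colour_sort q"
  shows "p = q"
  using assms
proof (induction p arbitrary: u u' q)
  case (Cons x p)
  from Cons.prems(3) obtain y r where q: "q = y # r" by (cases q) auto
  have w: "awalk (head G x) p v" "awalk (head G y) r v'"
    using Cons.prems q by (auto simp: awalk_Cons_iff)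
  have "x # colour_sort p = y # colour_sort r"
  proof (rule ins_inject)
    show "awalk u (x # colour_sort p) v" "awalk u' (y # colour_sort r) v'"
      using Cons.prems q by (auto simp: awalk_Cons_iff awalk_colour_sort)
    \<comment> \<open>The tails have equal colour sequences before sorting, hence also after
      it.\<close>
    show "colours (x # colour_sort p) = colours (y # colour_sort r)"
      using Cons.prems(3) q colours_colour_sort[OF w(1)] colours_colour_sort[OF w(2)] by simp
    show "ins x (colour_sort p) = ins y (colour_sort r)"
      using Cons.prems q by simp
  qed
  with Cons.IH[OF w] Cons.prems(3) q show ?case by simp
qed simp

text \<open>The rigidity behind uniqueness: both paths have the same sorted form, and sorting is
  injective for a given colour sequence.\<close>

lemma path_sim_same_colours_eq:
  assumes "path_sim u v p q" "colours p = colours q"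
  shows "p = q"
  using colour_sort_inject[of u p v u q v] assms path_equiv_ends[OF assms(1)]
    path_sim_imp_colour_sort_eq by blast

section \<open>Factorisation of paths\<close>

text \<open>Bring the colour to the front of the tail by induction; if the first edge has another
  colour, one more flip moves past it.\<close>

lemma bring_colour_to_front:
  assumes "awalk u p v" "c \<in> set (colours p)"
  obtains x q where "path_sim u v p (x # q)" "colour x = c"
proof -
  have "\<exists>x q. path_sim u v p (x # q) \<and> colour x = c"
    using assms
  proof (induction p arbitrary: u)
    case (Cons y p)
    show ?case
    proof (cases "colour y = c")
      case True
      with Cons.prems show ?thesis using path_sim_refl by blast
    next
      case False
      have y: "y \<in> arcs G" "u = tail G y" "awalk (head G y) p v"
        using Cons.prems by (auto simp: awalk_Cons_iff)
      have "c \<in> set (colours p)" using Cons.prems(2) False by auto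
      with Cons.IH[OF y(3)] obtain x q
        where x: "path_sim (head G y) v p (x # q)" "colour x = c" by blast
      have s: "path_sim u v (y # p) (y # x # q)"
        using path_sim_Cons[OF y(1) x(1)] y(2) by simp
      then have yx: "awalk u (y # x # q) v" using path_equiv_ends by blast
      then have "(y, x) \<in> bicoloured_paths k G E"
        using False x by (auto simp: bicoloured_iff awalk_Cons_iff)
      then obtain x' y' where f: "\<phi> (y, x) = (x', y')" "colour x' = colour x"
        by (rule flip_cases)
      have "path_sim u v (y # x # q) (x' # y' # q)"
        using path_sim_flip[OF yx _ f(1)] False x(2) by blast
      with s have "path_sim u v (y # p) (x' # y' # q)" by (rule path_sim_trans)
      with f x(2) show ?thesis by auto
    qed
  qed simp
  then show ?thesis using that by blast
qed

text \<open>Existence of factorisations: the colours of \<open>M\<close> are brought to the front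
  and split off one at a time.\<close>

lemma path_split:
  assumes "awalk u p v" "mset (colours p) = M + N"
  obtains q r where "path_sim u v p (q @ r)" "mset (colours q) = M" "mset (colours r) = N"
proof -
  have "\<exists>q r. path_sim u v p (q @ r) \<and> mset (colours q) = M \<and> mset (colours r) = N"
    using assms
  proof (induction M arbitrary: u p)
    case empty
    then have "path_sim u v p ([] @ p)" by (simp add: path_sim_refl)
    with empty show ?case by (metis add_0 list.map(1) mset.simps(1))
  next
    case (add c M)
    then have "c \<in># mset (colours p)" by simp
    then obtain x p' where x: "path_sim u v p (x # p')" "colour x = c"
      using bring_colour_to_front[OF add.prems(1), of c] by auto
    then have w: "x \<in> arcs G" "u = tail G x" "awalk (head G x) p' v"
      using path_equiv_ends[OF x(1)] by (auto simp: awalk_Cons_iff)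
    have "mset (colours p') = M + N"
      using path_sim_colours[OF x(1)] x(2) add.prems(2) by simp
    with add.IH w obtain q r where qr: "path_sim (head G x) v p' (q @ r)"
      "mset (colours q) = M" "mset (colours r) = N" by blast
    have "path_sim u v (x # p') (x # q @ r)"
      using path_sim_Cons[OF w(1) qr(1)] w by simp
    with x(1) have "path_sim u v p (x # q @ r)"
      by (rule path_sim_trans)
    with qr x show ?case by (intro exI[of _ "x # q"] exI[of _ r]) simp
  qed
  then show ?thesis using that by blast
qed

lemma path_split_unique:
  assumes q: "awalk u q w" and r: "awalk w r v" and q': "awalk u q' w'" and r': "awalk w' r' v"
    and sim: "path_sim u v (q @ r) (q' @ r')"
    and cq: "mset (colours q) = mset (colours q')" and cr: "mset (colours r) = mset (colours r')"
  shows "w = w' \<and> path_sim u w q q' \<and> path_sim w v r r'"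
proof -
  note s = path_sim_colour_sort[OF q] path_sim_colour_sort[OF r]
    path_sim_colour_sort[OF q'] path_sim_colour_sort[OF r']
  have c: "colours (colour_sort q) = colours (colour_sort q')"
    "colours (colour_sort r) = colours (colour_sort r')"
    using q r q' r' cq cr
    by (simp_all add: colours_colour_sort properties_for_sort)
  have "path_sim u v (colour_sort q @ colour_sort r) (colour_sort q' @ colour_sort r')"
    using path_sim_append[OF s(1,2)] path_sim_append[OF s(3,4)] sim
      path_sim_sym path_sim_trans by meson
  then have "colour_sort q @ colour_sort r = colour_sort q' @ colour_sort r'"
    by (rule path_sim_same_colours_eq) (simp add: c)
  \<comment> \<open>Equal colour sequences have equal length, so the concatenations split at the
    same place.\<close>
  then have e: "colour_sort q = colour_sort q'" "colour_sort r = colour_sort r'"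
    using c(1) by (metis append_eq_append_conv length_map)+
  \<comment> \<open>The intermediate vertex is the end of the sorted first factor, which is now
    common to both factorisations.\<close>
  have "awlast u (colour_sort q) = w" "awlast u (colour_sort q') = w'"
    using awalk_colour_sort[OF q] awalk_colour_sort[OF q'] by auto
  with e have "w = w'" by simp
  with e s show ?thesis using path_sim_sym path_sim_trans by metis
qed

section \<open>The quotient category and its classes of paths\<close>

lemma free_category_simps [simp]:
  "Obj (free_category G) = verts G"
  "Mor (free_category G) = dipaths G"
  "Dom (free_category G) (u, p, v) = u"
  "Cod (free_category G) (u, p, v) = v"
  "Id (free_category G) u = (u, [], u)"
  "Comp (free_category G) (u', q, v') (u, p, v) = (u, p @ q, v')"
  by (simp_all add: free_category_def)

sublocale Lambda: category_congruence "free_category G" "path_equiv k G E \<phi>"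
  rewrites "quotient_category (free_category G) (path_equiv k G E \<phi>) = Lambda_DG k G E \<phi>"
proof -
  interpret small_category "free_category G" by (rule small_category_free)
  show "category_congruence (free_category G) (path_equiv k G E \<phi>)"
  proof
    show "equiv (Mor (free_category G)) (path_equiv k G E \<phi>)"
      using equiv_path_equiv by simp
  next
    fix f f' assume R: "(f, f') \<in> path_equiv k G E \<phi>"
    obtain u p v u' p' v' where f: "f = (u, p, v)" "f' = (u', p', v')" by (cases f, cases f')
    with R path_equiv_ends[of u p v u' p' v'] show "Dom (free_category G) f = Dom (free_category G) f'"
      "Cod (free_category G) f = Cod (free_category G) f'" by auto
    fix g g' assume S: "(g, g') \<in> path_equiv k G E \<phi>"
      and c: "Dom (free_category G) g = Cod (free_category G) f"
    obtain w q t w' q' t' where g: "g = (w, q, t)" "g' = (w', q', t')" by (cases g, cases g')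
    \<comment> \<open>Composability supplies the common vertex at which
      \<open>path_sim_append\<close> joins the two equivalences.\<close>
    from R S c show "(Comp (free_category G) g f, Comp (free_category G) g' f')
        \<in> path_equiv k G E \<phi>"
      unfolding f g using path_equiv_ends[of u p v u' p' v'] path_equiv_ends[of w q t w' q' t']
      by (auto intro: path_sim_append)
  qed
qed (simp add: Lambda_DG_def)

abbreviation path_class :: "'v \<Rightarrow> 'e list \<Rightarrow> 'v \<Rightarrow> ('v, 'e) dipath set" where
  "path_class u p v \<equiv> path_equiv k G E \<phi> `` {(u, p, v)}"

lemma Lambda_cases:
  assumes "X \<in> Mor (Lambda_DG k G E \<phi>)"
  obtains u p v where "awalk u p v" "X = path_class u p v"
proof -
  obtain f where "f \<in> dipaths G" "X = path_equiv k G E \<phi> `` {f}"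
    using Lambda.quotient_cases[OF assms] by auto
  then show ?thesis using that by (cases f) (auto simp: dipaths_def)
qed

lemma path_class_in: "awalk u p v \<Longrightarrow> path_class u p v \<in> Mor (Lambda_DG k G E \<phi>)"
  using Lambda.class_in_quotient[of "(u, p, v)"] by (simp add: dipaths_def)

lemma Dom_path_class: "awalk u p v \<Longrightarrow> Dom (Lambda_DG k G E \<phi>) (path_class u p v) = u"
  using Lambda.Dom_class[of "(u, p, v)"] by (simp add: dipaths_def)

lemma Cod_path_class: "awalk u p v \<Longrightarrow> Cod (Lambda_DG k G E \<phi>) (path_class u p v) = v"
  using Lambda.Cod_class[of "(u, p, v)"] by (simp add: dipaths_def)

lemma Comp_path_class:
  "\<lbrakk>awalk u p w; awalk w q v\<rbrakk> \<Longrightarrow>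
    Comp (Lambda_DG k G E \<phi>) (path_class w q v) (path_class u p w) = path_class u (p @ q) v"
  using Lambda.Comp_class[of "(u, p, w)" "(w, q, v)"] by (simp add: dipaths_def)

lemma path_class_eq_iff:
  "awalk u p v \<Longrightarrow> awalk u q v \<Longrightarrow> path_class u p v = path_class u q v \<longleftrightarrow> path_sim u v p q"
  using eq_equiv_class_iff[OF equiv_path_equiv, of "(u, p, v)" "(u, q, v)"]
  by (simp add: dipaths_def)

section \<open>The degree functor\<close>

text \<open>The vector of colour multiplicities, constant on classes by
  \<open>path_sim_colours\<close>.\<close>

definition degree :: "('v, 'e) dipath set \<Rightarrow> nat \<Rightarrow> nat" where
  "degree X = the_elem ((\<lambda>(u, p, v). count (mset (colours p))) ` X)"

lemma degree_path_class:
  assumes "awalk u p v"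
  shows "degree (path_class u p v) = count (mset (colours p))"
proof -
  have "the_elem ((\<lambda>(u, p, v). count (mset (colours p))) ` path_class u p v) =
    (\<lambda>(u, p, v). count (mset (colours p))) (u, p, v)"
  proof (rule Lambda.the_elem_class)
    fix Q assume R: "((u, p, v), Q) \<in> path_equiv k G E \<phi>"
    obtain u' q v' where Q: "Q = (u', q, v')" by (cases Q)
    with R have "path_sim u v p q" using path_equiv_ends[of u p v u' q v'] by simp
    from path_sim_colours[OF this] show "(case Q of (u, p, v) \<Rightarrow> count (mset (colours p))) =
      (case (u, p, v) of (u, p, v) \<Rightarrow> count (mset (colours p)))"
      by (simp add: Q)
  qed (use assms in \<open>simp add: dipaths_def\<close>)
  then show ?thesis by (simp add: degree_def)
qed

lemma count_colours_in_Nk: "awalk u p v \<Longrightarrow> count (mset (colours p)) \<in> Nk k"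
  using colour_arc by (fastforce simp: Nk_def awalk_def count_eq_zero_iff)

lemma degree_functor_degree: "degree_functor k (Lambda_DG k G E \<phi>) degree"
  unfolding degree_functor_def
proof (intro category_functor.intro category_functor_axioms.intro)
  show "small_category (Lambda_DG k G E \<phi>)" ..
  show "small_category (Nk_category k)" by (rule small_category_Nk)
next
  fix X assume "X \<in> Mor (Lambda_DG k G E \<phi>)"
  then obtain u p v where X: "awalk u p v" "X = path_class u p v" by (rule Lambda_cases)
  then show "degree X \<in> Mor (Nk_category k)"
    by (simp add: Nk_category_def degree_path_class count_colours_in_Nk[simplified])
  fix Y assume "Y \<in> Mor (Lambda_DG k G E \<phi>)"
    and YX: "Dom (Lambda_DG k G E \<phi>) Y = Cod (Lambda_DG k G E \<phi>) X"
  then obtain w q t where Y: "awalk w q t" "Y = path_class w q t" by (auto elim: Lambda_cases)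
  have "w = v" using X Y YX by (simp add: Dom_path_class Cod_path_class)
  \<comment> \<open>Composition appends edge lists and so adds the colour counts; commutativity of
    addition absorbs the reversed order.\<close>
  with X Y show "degree (Comp (Lambda_DG k G E \<phi>) Y X) =
      Comp (Nk_category k) (degree Y) (degree X)"
    by (auto simp: Nk_category_def Comp_path_class degree_path_class fun_eq_iff)
next
  fix a assume "a \<in> Obj (Lambda_DG k G E \<phi>)"
  then have "awalk a [] a" by (simp add: awalk_Nil_iff)
  then show "degree (Id (Lambda_DG k G E \<phi>) a) = Id (Nk_category k) ()"
    by (simp add: Nk_category_def Lambda.Id_quotient degree_path_class fun_eq_iff)
qed (auto simp: Nk_category_def)

lemma degree_edge_morphism:
  assumes "i \<in> {1..k}" "x \<in> E i"
  shows "degree (edge_morphism k G E \<phi> x) = basis_vec i"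
  using degree_path_class[OF arc_implies_awalk[OF E_arcs[OF assms]]] colour_eq[OF assms]
  by (auto simp: edge_morphism_def basis_vec_def fun_eq_iff)

section \<open>Unique factorisation and countability\<close>

lemma unique_factorisation_degree: "unique_factorisation k (Lambda_DG k G E \<phi>) degree"
  unfolding unique_factorisation_def
proof (intro ballI impI)
  let ?L = "Lambda_DG k G E \<phi>"
  fix X m n
  assume "X \<in> Mor ?L" and m: "m \<in> Nk k" and n: "n \<in> Nk k" and d: "degree X = m + n"
  then obtain u p v where X: "awalk u p v" "X = path_class u p v" by (auto elim: Lambda_cases)
  \<comment> \<open>The multisets of colours with multiplicities \<open>m\<close> and
    \<open>n\<close>, to which \<open>path_split\<close> applies.\<close>
  define M where "M = Abs_multiset m"
  define N where "N = Abs_multiset n"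
  have M: "count M = m" and N: "count N = n"
    using m n by (simp_all add: M_def N_def count_Abs_multiset finite_support_Nk)
  \<comment> \<open>\<open>N\<close> comes first because the composite of \<open>\<mu>\<close> and
    \<open>\<nu>\<close> travels along \<open>\<nu>\<close>, of degree \<open>n\<close>, before
    \<open>\<mu>\<close>.\<close>
  have "mset (colours p) = N + M"
    using d X by (intro multiset_eqI) (simp add: degree_path_class M N fun_eq_iff)
  with X(1) obtain q r where qr: "path_sim u v p (q @ r)"
    "mset (colours q) = N" "mset (colours r) = M" by (rule path_split)
  then obtain w where w: "awalk u q w" "awalk w r v"
    using path_equiv_ends[OF qr(1)] by (auto simp: awalk_append_iff)
  have Xqr: "X = path_class u (q @ r) v"
    using X qr path_equiv_ends[OF qr(1)] by (simp add: path_class_eq_iff)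
  show "\<exists>!P. case P of (\<mu>, \<nu>) \<Rightarrow> \<mu> \<in> Mor ?L \<and> \<nu> \<in> Mor ?L \<and> Dom ?L \<mu> = Cod ?L \<nu> \<and>
    X = Comp ?L \<mu> \<nu> \<and> degree \<mu> = m \<and> degree \<nu> = n"
  proof (rule ex1I[of _ "(path_class w r v, path_class u q w)"])
    show "case (path_class w r v, path_class u q w) of (\<mu>, \<nu>) \<Rightarrow>
      \<mu> \<in> Mor ?L \<and> \<nu> \<in> Mor ?L \<and> Dom ?L \<mu> = Cod ?L \<nu> \<and>
      X = Comp ?L \<mu> \<nu> \<and> degree \<mu> = m \<and> degree \<nu> = n"
      using w qr by (simp add: path_class_in Dom_path_class Cod_path_class Comp_path_class
          degree_path_class Xqr M N)
  next
    fix P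
    assume "case P of (\<mu>, \<nu>) \<Rightarrow> \<mu> \<in> Mor ?L \<and> \<nu> \<in> Mor ?L \<and> Dom ?L \<mu> = Cod ?L \<nu> \<and>
      X = Comp ?L \<mu> \<nu> \<and> degree \<mu> = m \<and> degree \<nu> = n"
    then obtain \<mu> \<nu> where P: "P = (\<mu>, \<nu>)" "\<mu> \<in> Mor ?L" "\<nu> \<in> Mor ?L" "Dom ?L \<mu> = Cod ?L \<nu>"
      "X = Comp ?L \<mu> \<nu>" "degree \<mu> = m" "degree \<nu> = n" by (cases P) auto
    obtain w' r' v' where mu: "awalk w' r' v'" "\<mu> = path_class w' r' v'"
      using P(2) by (rule Lambda_cases)
    obtain u' q' w'' where nu: "awalk u' q' w''" "\<nu> = path_class u' q' w''"
      using P(3) by (rule Lambda_cases)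
    have w': "w'' = w'" using P mu nu by (simp add: Dom_path_class Cod_path_class)
    have X': "X = path_class u' (q' @ r') v'"
      using P mu nu w' by (simp add: Comp_path_class)
    have a: "awalk u (q @ r) v" "awalk u' (q' @ r') v'"
      using w mu nu w' by (auto intro: awalk_appendI)
    \<comment> \<open>Domain and codomain of the class \<open>X\<close> can be read off at either
      representative.\<close>
    have uv: "u' = u" "v' = v"
      using Xqr X' Dom_path_class[OF a(1)] Dom_path_class[OF a(2)]
        Cod_path_class[OF a(1)] Cod_path_class[OF a(2)] by auto
    have "w = w' \<and> path_sim u w q q' \<and> path_sim w v r r'"
    proof (rule path_split_unique)
      show "path_sim u v (q @ r) (q' @ r')"
        using Xqr X' a uv path_class_eq_iff[of u "q @ r" v "q' @ r'"] by blast
      show "mset (colours q) = mset (colours q')" "mset (colours r) = mset (colours r')"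
        using qr P mu nu by (auto simp: degree_path_class M N multiset_eq_iff)
    qed (use w mu nu uv w' in auto)
    then show "P = (path_class w r v, path_class u q w)"
      using P(1) mu nu uv w' w by (auto simp: path_class_eq_iff path_sim_sym)
  qed
qed

text \<open>A path is given by two vertices and a list over a finite set of edges, and the classes
  are an image of the set of paths.\<close>

lemma countable_Mor_Lambda: "countable (Mor (Lambda_DG k G E \<phi>))"
proof -
  have "dipaths G \<subseteq> verts G \<times> lists (arcs G) \<times> verts G"
    by (auto simp: dipaths_def awalk_def in_lists_conv_set awalk_last_in_verts)
  moreover have "countable (verts G \<times> lists (arcs G) \<times> verts G)"
    by (intro countable_SIGMA countable_lists countable_finite finite_verts finite_arcs)
  ultimately have "countable (dipaths G)" by (rule countable_subset)
  then show ?thesis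
    by (simp add: Lambda.Mor_quotient quotient_def)
qed

end

theorem theorem1p2:
  fixes G :: "('v, 'e) pre_digraph"
    and k :: nat
    and E :: "nat \<Rightarrow> 'e set"
    and \<phi> :: "'e \<times> 'e \<Rightarrow> 'e \<times> 'e"
  assumes "2 \<le> k"
    and "k_dim_digraph G k E \<phi>"
  shows "small_category (Lambda_DG k G E \<phi>) \<and> Obj (Lambda_DG k G E \<phi>) = verts G \<and>
    (\<exists>d. degree_functor k (Lambda_DG k G E \<phi>) d \<and>
      (\<forall>i\<in>{1..k}. \<forall>x\<in>E i. d (edge_morphism k G E \<phi> x) = basis_vec i) \<and>
      unique_factorisation k (Lambda_DG k G E \<phi>) d \<and>
      k_graph k (Lambda_DG k G E \<phi>) d)"
proof -
  interpret k_dim_digraph G k E \<phi> by fact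
  show ?thesis
    \<comment> \<open>The witness for \<open>d\<close> is \<open>degree\<close>; the objects are
      countable because \<open>verts G\<close> is finite.\<close>
    using Lambda.quotient.small_category_axioms degree_functor_degree degree_edge_morphism
      unique_factorisation_degree countable_Mor_Lambda countable_finite[OF finite_verts]
    by (auto simp: k_graph_def)
qed

end
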